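(* Let $A\in\mathbb{C}^{n\times n}$ be a power positive matrix. Then: (i) $\lambda_1(A)$ is simple and nonzero, and $|\lambda_2(A)|<|\lambda_1(A)|$. (ii) $\left(\lambda_1(A)^{-1}A\right)^p\to\frac{xy^{T}}{x^{T}y}>O$ as $p\to\infty$, where $x$ and $y$ are right and left positive eigenvectors of $A$ corresponding to $\lambda_1(A)$, respectively. (iii) $\lambda_1(A)^{-1}A$ is similar to a weakly doubly stochastic matrix via a diagonal plus rank one similarity transform. Moreover, (i) and (ii) are equivalent.
   Context: $M>O$ means that all entries of $M$ are real and positive; similarly for vectors. $A$ is power positive if $A^k>O$ for some integer $k\ge1$. The distinct eigenvalues of $A$ are listed as $\lambda_1(A),\lambda_2(A),\dots,\lambda_s(A)$ with $\rho(A)=|\lambda_1(A)|\ge|\lambda_2(A)|\ge\dots\ge|\lambda_s(A)|$, $\rho(A)$ being the spectral radius (the condition on $\lambda_2(A)$ is vacuous if $s=1$). A right eigenvector satisfies $Ax=\lambda_1(A)x$, a left eigenvector $y^{T}A=\lambda_1(A)y^{T}$. With $e=(1,\dots,1)^{T}$, a complex square matrix $B$ is weakly doubly stochastic if $Be=e$ and $B^{T}e=e$ (no nonnegativity required). A diagonal plus rank one similarity transform is a similarity $M\mapsto SMS^{-1}$ with $S$ an invertible matrix of the form $S=D+uv^{T}$, $D$ diagonal and $u,v$ vectors. *)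

theory Defs
  imports
    "Jordan_Normal_Form.Matrix"
    "Jordan_Normal_Form.Char_Poly"
    "Jordan_Normal_Form.Spectral_Radius"
begin

definition pos_complex :: "complex \<Rightarrow> bool" where
  "pos_complex z \<longleftrightarrow> z \<in> \<real> \<and> 0 < Re z"

definition pos_mat :: "complex mat \<Rightarrow> bool" where
  "pos_mat M \<longleftrightarrow> (\<forall>i<dim_row M. \<forall>j<dim_col M. pos_complex (M $$ (i,j)))"

definition pos_vec :: "complex vec \<Rightarrow> bool" where
  "pos_vec v \<longleftrightarrow> (\<forall>i<dim_vec v. pos_complex (v $ i))"

definition power_positive :: "complex mat \<Rightarrow> bool" where
  "power_positive A \<longleftrightarrow> (\<exists>k\<ge>1. pos_mat (A ^\<^sub>m k))"

text \<open>A listing of the distinct eigenvalues by non-increasing modulus. Eigenvalues of equal modulus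
  may come in any order, so the listing is not unique in general; the i-th eigenvalue of the
  mathematical notation is \<open>ls ! (i - 1)\<close>.\<close>

definition eigenvalue_listing :: "complex mat \<Rightarrow> complex list \<Rightarrow> bool" where
  "eigenvalue_listing A ls \<longleftrightarrow>
     distinct ls \<and> set ls = spectrum A \<and> sorted_wrt (\<lambda>a b. cmod a \<ge> cmod b) ls"

text \<open>The equation \<open>y\<^sup>T A = l y\<^sup>T\<close>, without complex conjugation, is stated in transposed form.\<close>

definition left_eigenvector :: "complex mat \<Rightarrow> complex vec \<Rightarrow> complex \<Rightarrow> bool" where
  "left_eigenvector A y l \<longleftrightarrow> eigenvector (transpose_mat A) y l"

definition pos_eigenvectors :: "complex mat \<Rightarrow> complex \<Rightarrow> complex vec \<Rightarrow> complex vec \<Rightarrow> bool" where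
  "pos_eigenvectors A l x y \<longleftrightarrow>
     eigenvector A x l \<and> pos_vec x \<and> left_eigenvector A y l \<and> pos_vec y"

definition outer :: "complex vec \<Rightarrow> complex vec \<Rightarrow> complex mat" where
  "outer u v = mat (dim_vec u) (dim_vec v) (\<lambda>(i,j). u $ i * v $ j)"

text \<open>Matrices of a fixed size converge entrywise, which is convergence in any matrix norm.\<close>

definition mat_tendsto :: "(nat \<Rightarrow> complex mat) \<Rightarrow> complex mat \<Rightarrow> bool" where
  "mat_tendsto M L \<longleftrightarrow>
     (\<forall>p. M p \<in> carrier_mat (dim_row L) (dim_col L)) \<and>
     (\<forall>i<dim_row L. \<forall>j<dim_col L. (\<lambda>p. M p $$ (i,j)) \<longlonglongrightarrow> L $$ (i,j))"

text \<open>Simplicity is algebraic: multiplicity one as a root of the characteristic polynomial.\<close>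

definition simple_dominant :: "complex mat \<Rightarrow> complex list \<Rightarrow> bool" where
  "simple_dominant A ls \<longleftrightarrow>
     order (ls ! 0) (char_poly A) = 1 \<and> ls ! 0 \<noteq> 0 \<and>
     (1 < length ls \<longrightarrow> cmod (ls ! 1) < cmod (ls ! 0))"

text \<open>Positive eigenvectors exist, and every choice of them gives the stated positive limit.
  Here \<open>x \<bullet> y\<close> is the bilinear product \<open>x\<^sup>T y\<close>.\<close>

definition powers_tendsto_positive :: "complex mat \<Rightarrow> complex \<Rightarrow> bool" where
  "powers_tendsto_positive A l \<longleftrightarrow>
     (\<exists>x y. pos_eigenvectors A l x y) \<and>
     (\<forall>x y. pos_eigenvectors A l x y \<longrightarrow>
        mat_tendsto (\<lambda>p. (inverse l \<cdot>\<^sub>m A) ^\<^sub>m p) (inverse (x \<bullet> y) \<cdot>\<^sub>m outer x y) \<and>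
        pos_mat (inverse (x \<bullet> y) \<cdot>\<^sub>m outer x y))"

definition weakly_doubly_stochastic :: "complex mat \<Rightarrow> bool" where
  "weakly_doubly_stochastic B \<longleftrightarrow> square_mat B \<and>
     (let e = vec (dim_row B) (\<lambda>_. 1) in B *\<^sub>v e = e \<and> transpose_mat B *\<^sub>v e = e)"

definition diag_plus_rank_one :: "nat \<Rightarrow> complex mat \<Rightarrow> bool" where
  "diag_plus_rank_one n S \<longleftrightarrow>
     (\<exists>D u v. D \<in> carrier_mat n n \<and> diagonal_mat D \<and> u \<in> carrier_vec n \<and> v \<in> carrier_vec n \<and>
        S = D + outer u v)"

text \<open>\<open>similar_mat_wit B M S T\<close> says that \<open>T\<close> is the inverse of \<open>S\<close> and \<open>B = S M T\<close>.\<close>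

definition dpr1_similar :: "complex mat \<Rightarrow> complex mat \<Rightarrow> bool" where
  "dpr1_similar M B \<longleftrightarrow>
     (\<exists>S T. diag_plus_rank_one (dim_row M) S \<and> similar_mat_wit B M S T)"

end

theory Submission
  imports Defs
begin

text \<open>The starting point is Perron's theorem in Wielandt's form: if \<open>P\<close> is a positive matrix, each
eigenvector for an eigenvalue of maximal modulus is a scalar multiple of a positive vector
(\<open>peripheral_eigenvector_positive\<close>). An eigenvector of a power positive matrix \<open>A\<close> is an eigenvector of
its positive power, so \<open>A\<close> inherits this property. The same applies to the transpose, which provides a
positive left eigenvector \<open>y\<close> for \<open>l = \<lambda>\<^sub>1(A)\<close>. Since \<open>y\<close> pairs nontrivially with every positive vector,
no second eigenvalue can share the maximal modulus, and no eigenvector for \<open>l\<close> is orthogonal to \<open>y\<close>.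

For the limit, set \<open>B = l\<^sup>-\<^sup>1 A\<close> and \<open>L = x y\<^sup>T / (x\<^sup>T y)\<close>, so that \<open>B L = L B = L L = L\<close> and
\<open>(B - L) ^ p = B ^ p - L\<close> for \<open>p \<ge> 1\<close>. A nonzero eigenvalue of \<open>B - L\<close> is one of \<open>B\<close> with an eigenvector
orthogonal to \<open>y\<close>. If no such eigenvector belongs to the eigenvalue one, then \<open>B - L\<close> has spectral radius
below one and \<open>B ^ p\<close> tends to \<open>L\<close>.

Algebraic simplicity is read off from traces. If all other eigenvalues of \<open>A\<close> have modulus below \<open>|l|\<close>,
the trace of \<open>B ^ p\<close> tends to the multiplicity of \<open>l\<close> (\<open>trace_pow_tendsto_order\<close>), while \<open>L\<close> has trace one.
Hence convergence of \<open>B ^ p\<close> to \<open>L\<close> gives multiplicity one. Conversely, for multiplicity one the same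
count applied to \<open>B - L\<close> shows that one is not among its eigenvalues, so \<open>B ^ p\<close> converges to \<open>L\<close>. As
convergent powers also exclude further eigenvalues of modulus \<open>|l|\<close>, this yields the equivalence of the
first two parts for matrices with positive eigenvectors.

For the similarity, normalize \<open>y\<close> so that \<open>x \<bullet> y = n\<close>. Any invertible \<open>S\<close> with \<open>S x = e\<close> and
\<open>S\<^sup>T e = y\<close> conjugates \<open>B\<close> to a weakly doubly stochastic matrix, and a scalar matrix plus a matrix of
rank one can be chosen to meet both conditions.\<close>

section \<open>Powers of matrices\<close>

lemma pow_mat_Suc_left:
  fixes A :: "'a :: comm_ring_1 mat"
  assumes A: "A \<in> carrier_mat n n"
  shows "A ^\<^sub>m Suc k = A * A ^\<^sub>m k"
proof (induction k)
  case (Suc k)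
  have "A ^\<^sub>m Suc (Suc k) = (A * A ^\<^sub>m k) * A"
    using Suc by simp
  also have "\<dots> = A * A ^\<^sub>m Suc k"
    using A by (simp add: assoc_mult_mat[OF A pow_carrier_mat[OF A] A])
  finally show ?case .
qed (use A in simp)

lemma pow_mat_smult:
  fixes A :: "'a :: comm_ring_1 mat"
  assumes A: "A \<in> carrier_mat n n"
  shows "(c \<cdot>\<^sub>m A) ^\<^sub>m k = c ^ k \<cdot>\<^sub>m (A ^\<^sub>m k)"
proof (induction k)
  case 0
  show ?case by (rule eq_matI) (use A in auto)
next
  case (Suc k)
  have "(c \<cdot>\<^sub>m A) ^\<^sub>m Suc k = (c ^ k \<cdot>\<^sub>m (A ^\<^sub>m k)) * (c \<cdot>\<^sub>m A)"
    using Suc by simp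
  also have "\<dots> = c \<cdot>\<^sub>m (c ^ k \<cdot>\<^sub>m (A ^\<^sub>m k * A))"
    using A by (simp add: mult_smult_distrib[of _ n n _ n] mult_smult_assoc_mat[of _ n n _ n])
  also have "\<dots> = c ^ Suc k \<cdot>\<^sub>m (A ^\<^sub>m Suc k)"
    by (rule eq_matI) (use A in \<open>auto simp: mult.assoc\<close>)
  finally show ?case .
qed

lemma pow_mat_transpose:
  fixes A :: "'a :: comm_ring_1 mat"
  assumes A: "A \<in> carrier_mat n n"
  shows "transpose_mat A ^\<^sub>m k = transpose_mat (A ^\<^sub>m k)"
proof (induction k)
  case (Suc k)
  then show ?case
    using A pow_mat_Suc_left[OF A, of k]
    by (simp add: transpose_mult[of _ n n _ n])
qed (use A in simp)

lemma mult_mat_vec_sum: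
  assumes "A \<in> carrier_mat n m" "v \<in> carrier_vec m" "i < n"
  shows "(A *\<^sub>v v) $ i = (\<Sum>j<m. A $$ (i,j) * v $ j)"
  using assms by (auto simp: scalar_prod_def lessThan_atLeast0 intro!: sum.cong)

lemma mult_mat_sum:
  assumes "A \<in> carrier_mat n m" "B \<in> carrier_mat m l" "i < n" "j < l"
  shows "(A * B) $$ (i,j) = (\<Sum>k<m. A $$ (i,k) * B $$ (k,j))"
  using assms by (auto simp: scalar_prod_def lessThan_atLeast0 intro!: sum.cong)

lemma eigenvector_smult_iff:
  fixes A :: "complex mat"
  assumes A: "A \<in> carrier_mat n n" and c: "c \<noteq> 0"
  shows "eigenvector (c \<cdot>\<^sub>m A) v (c * \<mu>) \<longleftrightarrow> eigenvector A v \<mu>"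
proof -
  have "(c \<cdot>\<^sub>m A) *\<^sub>v v = (c * \<mu>) \<cdot>\<^sub>v v \<longleftrightarrow> A *\<^sub>v v = \<mu> \<cdot>\<^sub>v v" if v: "v \<in> carrier_vec n"
  proof -
    have "(c \<cdot>\<^sub>m A) *\<^sub>v v = c \<cdot>\<^sub>v (A *\<^sub>v v)"
      by (rule eq_vecI) (use A v in auto)
    moreover have "(c * \<mu>) \<cdot>\<^sub>v v = c \<cdot>\<^sub>v (\<mu> \<cdot>\<^sub>v v)"
      by (simp add: smult_smult_assoc)
    ultimately show ?thesis
      using c A v by (auto simp: vec_eq_iff)
  qed
  then show ?thesis
    using A by (auto simp: eigenvector_def)
qed

text \<open>Matrices of spectral radius below one have bounded powers. Dividing by some \<open>t\<close> strictly between the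
spectral radius and one keeps the spectral radius below one, so the powers are even bounded by a
multiple of \<open>t ^ k\<close>.\<close>

lemma powers_tendsto_zero:
  assumes A: "A \<in> carrier_mat n n" and n: "n > 0"
    and small: "\<And>\<mu>. eigenvalue A \<mu> \<Longrightarrow> cmod \<mu> < 1"
    and ij: "i < n" "j < n"
  shows "(\<lambda>k. (A ^\<^sub>m k) $$ (i,j)) \<longlonglongrightarrow> 0"
proof -
  have "spectral_radius A < 1"
    using spectral_radius_mem_max(1)[OF A n] small by (auto simp: spectrum_def)
  then obtain t where t: "spectral_radius A < t" "t < 1" "0 < t"
    using dense[of "max 0 (spectral_radius A)" 1] by auto
  let ?B = "complex_of_real (1 / t) \<cdot>\<^sub>m A"
  have B: "?B \<in> carrier_mat n n" using A by simp
  have "cmod \<nu> < 1" if "eigenvalue ?B \<nu>" for \<nu>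
  proof -
    obtain v where "eigenvector ?B v (complex_of_real (1 / t) * (t * \<nu>))"
      using \<open>eigenvalue ?B \<nu>\<close> t(3) by (auto simp: eigenvalue_def)
    then have "eigenvalue A (t * \<nu>)"
      using eigenvector_smult_iff[OF A, of "complex_of_real (1 / t)" v "t * \<nu>"] t(3)
      by (auto simp: eigenvalue_def)
    then have "cmod (t * \<nu>) \<le> spectral_radius A"
      by (intro spectral_radius_mem_max(2)[OF A n]) (auto simp: spectrum_def)
    then have "t * cmod \<nu> \<le> spectral_radius A" using t(3) by (simp add: norm_mult)
    also have "\<dots> < t * 1" using t(1) by simp
    finally show ?thesis using t(3) by (simp only: mult_less_cancel_left_pos)
  qed
  then have "spectral_radius ?B < 1"
    using spectral_radius_mem_max(1)[OF B n] by (auto simp: spectrum_def)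
  then obtain b where b: "\<And>k. norm_bound (?B ^\<^sub>m k) b"
    using spectral_radius_jnf_norm_bound_less_1_upper_triangular[OF B] by blast
  have "norm ((A ^\<^sub>m k) $$ (i,j)) \<le> t ^ k * b" for k
  proof -
    have "?B ^\<^sub>m k = complex_of_real (1 / t) ^ k \<cdot>\<^sub>m (A ^\<^sub>m k)"
      by (rule pow_mat_smult[OF A])
    then have "norm (complex_of_real (1 / t) ^ k * (A ^\<^sub>m k) $$ (i,j)) \<le> b"
      using b[of k] ij A by (auto simp: norm_bound_def)
    then show ?thesis
      using t(3) by (simp add: norm_mult norm_power norm_divide field_simps)
  qed
  then have "\<forall>\<^sub>F k in sequentially. norm ((A ^\<^sub>m k) $$ (i,j)) \<le> norm (t ^ k) * b"
    using t(3) by (intro always_eventually) simp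
  moreover have "(\<lambda>k. t ^ k) \<longlonglongrightarrow> 0"
    using t by (intro LIMSEQ_power_zero) auto
  ultimately show ?thesis
    by (rule tendsto_0_le[rotated])
qed

section \<open>Eigenvectors of maximal modulus of positive matrices\<close>

text \<open>A positive vector \<open>z\<close> with \<open>P z \<ge> s z\<close> forces growth of order \<open>s ^ k\<close>: if every eigenvalue had modulus
below \<open>s\<close>, the powers of \<open>Q = P / s\<close> would tend to zero, although \<open>Q ^ k z \<ge> z\<close> by nonnegativity.
Only such a vector, not an eigenvector, is available when this is used to bound the spectral radius
from below.\<close>

lemma collatz_wielandt_lower_bound:
  fixes p :: "nat \<Rightarrow> nat \<Rightarrow> real" and z :: "nat \<Rightarrow> real"
  assumes P: "P \<in> carrier_mat n n" and n: "n > 0"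
    and entries: "\<And>i j. i < n \<Longrightarrow> j < n \<Longrightarrow> P $$ (i,j) = complex_of_real (p i j) \<and> 0 \<le> p i j"
    and z: "\<And>i. i < n \<Longrightarrow> 0 < z i" and s: "0 < s"
    and super: "\<And>i. i < n \<Longrightarrow> s * z i \<le> (\<Sum>j<n. p i j * z j)"
  shows "\<exists>\<mu>. eigenvalue P \<mu> \<and> s \<le> cmod \<mu>"
proof (rule ccontr)
  assume "\<not> ?thesis"
  then have small: "cmod \<mu> < s" if "eigenvalue P \<mu>" for \<mu>
    using that by (meson not_le)
  define c where "c = complex_of_real (1 / s)"
  define Q where "Q = c \<cdot>\<^sub>m P"
  define w where "w = vec n (\<lambda>i. complex_of_real (z i))"
  have Q: "Q \<in> carrier_mat n n" and w: "w \<in> carrier_vec n" and c: "c \<noteq> 0"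
    using P s by (auto simp: Q_def w_def c_def)
  have "cmod \<nu> < 1" if "eigenvalue Q \<nu>" for \<nu>
  proof -
    obtain v where "eigenvector Q v \<nu>"
      using \<open>eigenvalue Q \<nu>\<close> by (auto simp: eigenvalue_def)
    moreover have "\<nu> = c * (s * \<nu>)" using s by (simp add: c_def)
    ultimately have "eigenvector P v (s * \<nu>)"
      using eigenvector_smult_iff[OF P c] by (metis Q_def)
    then have "eigenvalue P (s * \<nu>)" by (auto simp: eigenvalue_def)
    from small[OF this] show ?thesis using s by (simp add: norm_mult)
  qed
  then have to0: "(\<lambda>k. (Q ^\<^sub>m k) $$ (i,j)) \<longlonglongrightarrow> 0" if "i < n" "j < n" for i j
    using powers_tendsto_zero[OF Q n] that by blast
  have grow: "z i \<le> Re ((Q ^\<^sub>m k *\<^sub>v w) $ i)" if "i < n" for i k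
    using that
  proof (induction k arbitrary: i)
    case 0
    then show ?case using Q w by (simp add: w_def)
  next
    case (Suc k)
    have Qk: "Q ^\<^sub>m k *\<^sub>v w \<in> carrier_vec n"
      by (rule mult_mat_vec_carrier[OF pow_carrier_mat[OF Q] w])
    have "z i \<le> (\<Sum>j<n. p i j / s * z j)"
      using super[OF Suc.prems] s by (simp add: field_simps flip: sum_divide_distrib)
    also have "\<dots> \<le> (\<Sum>j<n. p i j / s * Re ((Q ^\<^sub>m k *\<^sub>v w) $ j))"
      using entries Suc s by (intro sum_mono mult_left_mono) auto
    also have "\<dots> = Re (\<Sum>j<n. Q $$ (i,j) * (Q ^\<^sub>m k *\<^sub>v w) $ j)"
      using Suc.prems P entries by (auto simp: Q_def c_def intro!: sum.cong)
    also have "\<dots> = Re ((Q *\<^sub>v (Q ^\<^sub>m k *\<^sub>v w)) $ i)"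
      using mult_mat_vec_sum[OF Q Qk Suc.prems] by simp
    also have "Q *\<^sub>v (Q ^\<^sub>m k *\<^sub>v w) = Q ^\<^sub>m Suc k *\<^sub>v w"
      unfolding pow_mat_Suc_left[OF Q]
      by (rule assoc_mult_mat_vec[OF Q pow_carrier_mat[OF Q] w, symmetric])
    finally show ?case .
  qed
  have "(\<lambda>k. \<Sum>j<n. (Q ^\<^sub>m k) $$ (0,j) * w $ j) \<longlonglongrightarrow> (\<Sum>j<n. 0 * w $ j)"
    using n by (intro tendsto_sum tendsto_mult_right to0) auto
  then have "(\<lambda>k. Re ((Q ^\<^sub>m k *\<^sub>v w) $ 0)) \<longlonglongrightarrow> 0"
    using tendsto_Re mult_mat_vec_sum[OF pow_carrier_mat[OF Q] w n] by fastforce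
  then have "z 0 \<le> 0"
    using grow[OF n] by (intro LIMSEQ_le_const) auto
  then show False using z[OF n] by simp
qed

text \<open>In the case of equality of the triangle inequality all summands point in the direction \<open>c\<close> of the
total: after rotating by \<open>cnj c\<close>, a sum of the nonnegative defects \<open>cmod (v j) - Re (cnj c * v j)\<close> with
positive weights vanishes.\<close>

lemma triangle_equality_phase:
  fixes q :: "nat \<Rightarrow> real" and v :: "nat \<Rightarrow> complex"
  assumes q: "\<And>j. j < n \<Longrightarrow> 0 < q j"
    and eq: "cmod (\<Sum>j<n. complex_of_real (q j) * v j) = (\<Sum>j<n. q j * cmod (v j))"
    and nz: "(\<Sum>j<n. q j * cmod (v j)) \<noteq> 0"
  shows "\<exists>c. cmod c = 1 \<and> (\<forall>j<n. v j = c * complex_of_real (cmod (v j)))"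
proof -
  define S where "S = (\<Sum>j<n. complex_of_real (q j) * v j)"
  define c where "c = sgn S"
  have S: "S \<noteq> 0" using eq nz by (auto simp: S_def)
  then have c: "cmod c = 1" by (simp add: c_def norm_sgn)
  then have cc: "c * cnj c = 1" by (simp add: complex_norm_square[symmetric])
  have S_eq: "S = c * cmod S"
    using S by (simp add: c_def sgn_div_norm scaleR_conv_of_real)
  have le: "Re (cnj c * v j) \<le> cmod (v j)" for j
    using complex_Re_le_cmod[of "cnj c * v j"] c by (simp add: norm_mult)
  have "(\<Sum>j<n. q j * Re (cnj c * v j)) = Re (cnj c * S)"
    by (simp add: S_def sum_distrib_left algebra_simps)
  also have "cnj c * S = cmod S"
    using S_eq cc by (metis mult.assoc mult.commute mult_1)
  finally have "(\<Sum>j<n. q j * (cmod (v j) - Re (cnj c * v j))) = 0"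
    using eq by (simp add: right_diff_distrib sum_subtractf S_def)
  then have "\<forall>j\<in>{..<n}. q j * (cmod (v j) - Re (cnj c * v j)) = 0"
    using q le by (subst (asm) sum_nonneg_eq_0_iff) (auto intro!: mult_nonneg_nonneg simp: less_imp_le)
  then have Re: "Re (cnj c * v j) = cmod (cnj c * v j)" if "j < n" for j
  proof -
    have "q j * (cmod (v j) - Re (cnj c * v j)) = 0"
      using \<open>\<forall>j\<in>{..<n}. _\<close> that by blast
    then have "Re (cnj c * v j) = cmod (v j)"
      using q[OF that] by (metis eq_iff_diff_eq_0 mult_eq_0_iff less_irrefl)
    then show ?thesis using c by (simp only: norm_mult complex_mod_cnj mult_1)
  qed
  have "v j = c * cmod (v j)" if "j < n" for j
  proof -
    have "Im (cnj c * v j) = 0"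
      using Re[OF that] cmod_power2[of "cnj c * v j"] by simp
    then have "cnj c * v j = cmod (cnj c * v j)"
      using Re[OF that] by (simp add: complex_eq_iff)
    then have "c * (cnj c * v j) = c * cmod (v j)"
      using c by (simp add: norm_mult)
    then show ?thesis using cc by (simp flip: mult.assoc)
  qed
  then show ?thesis using c by blast
qed

text \<open>Wielandt's argument. With \<open>a = |v|\<close> and \<open>r = |\<mu>|\<close>, the triangle inequality gives \<open>r a \<le> P a\<close>. If this
were strict somewhere, applying the positive matrix \<open>P\<close> once more would make it strict everywhere for
\<open>b = P a\<close>, so \<open>P b \<ge> s b\<close> for some \<open>s > r\<close>, which contradicts the maximality of \<open>r\<close> by the
Collatz--Wielandt bound. Hence \<open>P a = r a\<close>, and equality in the triangle inequality makes \<open>v\<close> a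
unimodular multiple of \<open>a\<close>.\<close>

lemma peripheral_eigenvector_positive:
  assumes P: "P \<in> carrier_mat n n" and n: "n > 0" and pos: "pos_mat P"
    and ev: "eigenvector P v \<mu>"
    and max: "\<And>\<nu>. eigenvalue P \<nu> \<Longrightarrow> cmod \<nu> \<le> cmod \<mu>"
  shows "\<exists>c w. c \<noteq> 0 \<and> w \<in> carrier_vec n \<and> pos_vec w \<and> v = c \<cdot>\<^sub>v w"
proof -
  define p where "p i j = Re (P $$ (i,j))" for i j
  define r where "r = cmod \<mu>"
  define a where "a j = cmod (v $ j)" for j
  define b where "b i = (\<Sum>j<n. p i j * a j)" for i
  have p: "P $$ (i,j) = complex_of_real (p i j)" "0 < p i j" if "i < n" "j < n" for i j
    using pos P that by (auto simp: pos_mat_def pos_complex_def p_def)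
  have v: "v \<in> carrier_vec n" and v0: "v \<noteq> 0\<^sub>v n" and Pv: "P *\<^sub>v v = \<mu> \<cdot>\<^sub>v v"
    using ev P by (auto simp: eigenvector_def)
  obtain l where l: "l < n" "a l > 0"
    using v v0 by (auto simp: vec_eq_iff a_def)
  have strict: "0 < (\<Sum>j<n. p i j * f j)"
    if "i < n" "m < n" "0 < f m" "\<And>j. j < n \<Longrightarrow> 0 \<le> f j" for i m f
    using that p by (intro sum_pos2[of _ m]) (auto intro!: mult_nonneg_nonneg mult_pos_pos simp: less_imp_le)
  have a0: "0 \<le> a j" for j by (simp add: a_def)
  have b_pos: "0 < b i" if "i < n" for i
    unfolding b_def by (rule strict[of i l a]) (use that l a0 in auto)
  have row: "\<mu> * v $ i = (\<Sum>j<n. complex_of_real (p i j) * v $ j)" if "i < n" for i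
    using mult_mat_vec_sum[OF P v that] Pv v that p by auto
  have sub: "r * a i \<le> b i" if "i < n" for i
  proof -
    have "r * a i = cmod (\<Sum>j<n. complex_of_real (p i j) * v $ j)"
      using row[OF that] by (simp add: r_def a_def flip: norm_mult)
    also have "\<dots> \<le> (\<Sum>j<n. cmod (complex_of_real (p i j) * v $ j))" by (rule norm_sum)
    also have "\<dots> = b i"
      using p that by (auto simp: b_def a_def norm_mult abs_of_pos intro!: sum.cong)
    finally show ?thesis .
  qed
  have eq: "r * a i = b i" if "i < n" for i
  proof (rule ccontr)
    assume "r * a i \<noteq> b i"
    then have gap: "0 < b i - r * a i" using sub[OF that] by simp
    have gt: "r * b k < (\<Sum>j<n. p k j * b j)" if "k < n" for k
    proof -
      have "0 < (\<Sum>j<n. p k j * (b j - r * a j))"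
        using sub gap by (intro strict[of k i "\<lambda>j. b j - r * a j"]) (use that \<open>i < n\<close> in auto)
      also have "\<dots> = (\<Sum>j<n. p k j * b j) - r * b k"
        unfolding b_def[of k] by (simp add: algebra_simps sum_subtractf sum_distrib_left)
      finally show ?thesis by simp
    qed
    \<comment> \<open>The smallest of the finitely many growth ratios still exceeds \<open>r\<close>.\<close>
    define s where "s = Min ((\<lambda>k. (\<Sum>j<n. p k j * b j) / b k) ` {..<n})"
    have "s \<in> (\<lambda>k. (\<Sum>j<n. p k j * b j) / b k) ` {..<n}"
      unfolding s_def using n by (intro Min_in) auto
    then have rs: "r < s" using gt b_pos by (auto simp: field_simps)
    have "s * b k \<le> (\<Sum>j<n. p k j * b j)" if "k < n" for k
    proof -
      have "s \<le> (\<Sum>j<n. p k j * b j) / b k"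
        unfolding s_def using that by (intro Min_le) auto
      then show ?thesis using b_pos[OF that] by (simp add: field_simps)
    qed
    moreover have "0 < s" using rs by (simp add: r_def order.strict_trans1[OF norm_ge_zero])
    ultimately obtain \<nu> where "eigenvalue P \<nu>" "s \<le> cmod \<nu>"
      using collatz_wielandt_lower_bound[OF P n, of p b s] p b_pos by (metis less_imp_le)
    then show False using max rs by (fastforce simp: r_def)
  qed
  have a_pos: "0 < a i" if "i < n" for i
    using eq[OF that] b_pos[OF that] a0[of i] by (cases "a i = 0") auto
  have "cmod (\<Sum>j<n. complex_of_real (p 0 j) * v $ j) = b 0"
    using row[OF n] eq[OF n] by (simp add: r_def a_def flip: norm_mult)
  then obtain c where c: "cmod c = 1" "\<forall>j<n. v $ j = c * complex_of_real (a j)"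
    using triangle_equality_phase[of n "p 0" "\<lambda>j. v $ j"] p n b_pos[OF n]
    by (auto simp: b_def a_def)
  let ?w = "vec n (\<lambda>j. complex_of_real (a j))"
  have "v = c \<cdot>\<^sub>v ?w"
    using c v by (auto simp: vec_eq_iff)
  moreover have "pos_vec ?w" "c \<noteq> 0"
    using a_pos c by (auto simp: pos_vec_def pos_complex_def)
  ultimately show ?thesis
    by (intro exI[of _ c] exI[of _ ?w]) auto
qed

section \<open>Multiplicities as limits of traces\<close>

definition trace :: "complex mat \<Rightarrow> complex" where
  "trace M = (\<Sum>i<dim_row M. M $$ (i,i))"

lemma trace_mult_commute:
  assumes "M \<in> carrier_mat n m" "N \<in> carrier_mat m n"
  shows "trace (M * N) = trace (N * M)"
proof -
  have "trace (M * N) = (\<Sum>i<n. \<Sum>k<m. M $$ (i,k) * N $$ (k,i))"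
    using assms by (auto simp: trace_def mult_mat_sum simp del: index_mult_mat(1) intro!: sum.cong)
  also have "\<dots> = (\<Sum>k<m. \<Sum>i<n. N $$ (k,i) * M $$ (i,k))"
    by (subst sum.swap) (simp add: mult.commute)
  also have "\<dots> = trace (N * M)"
    using assms by (auto simp: trace_def mult_mat_sum simp del: index_mult_mat(1) intro!: sum.cong)
  finally show ?thesis .
qed

lemma upper_triangular_mult_diag:
  fixes S T :: "complex mat"
  assumes S: "S \<in> carrier_mat n n" "upper_triangular S"
    and T: "T \<in> carrier_mat n n" "upper_triangular T"
  shows "upper_triangular (S * T)"
    and "i < n \<Longrightarrow> (S * T) $$ (i,i) = S $$ (i,i) * T $$ (i,i)"
proof -
  have zero: "S $$ (i,k) * T $$ (k,j) = 0" if "k \<noteq> i" "j \<le> i" "i < n" "k < n" for i j k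
    using that S T upper_triangularD[of S k i] upper_triangularD[of T j k] by (cases "k < i") auto
  show "upper_triangular (S * T)"
  proof
    fix i j assume ij: "j < i" "i < dim_row (S * T)"
    then have "(S * T) $$ (i,j) = (\<Sum>k<n. S $$ (i,k) * T $$ (k,j))"
      using S T by (intro mult_mat_sum[of S n n T n]) auto
    also have "\<dots> = 0"
    proof (intro sum.neutral ballI)
      fix k assume "k \<in> {..<n}"
      then show "S $$ (i,k) * T $$ (k,j) = 0"
        using ij S T zero[of k i j] by (cases "k = i") (auto dest: upper_triangularD)
    qed
    finally show "(S * T) $$ (i,j) = 0" .
  qed
  assume i: "i < n"
  have "(S * T) $$ (i,i) = (\<Sum>k<n. S $$ (i,k) * T $$ (k,i))"
    using S T i by (intro mult_mat_sum[of S n n T n]) auto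
  also have "\<dots> = (\<Sum>k<n. if k = i then S $$ (i,i) * T $$ (i,i) else 0)"
    using i zero by (intro sum.cong) auto
  finally show "(S * T) $$ (i,i) = S $$ (i,i) * T $$ (i,i)"
    using i by simp
qed

lemma upper_triangular_pow_diag:
  fixes T :: "complex mat"
  assumes T: "T \<in> carrier_mat n n" "upper_triangular T"
  shows "upper_triangular (T ^\<^sub>m k) \<and> (\<forall>i<n. (T ^\<^sub>m k) $$ (i,i) = (T $$ (i,i)) ^ k)"
proof (induction k)
  case (Suc k)
  then show ?case
    using upper_triangular_mult_diag[of "T ^\<^sub>m k" n T] T by simp
qed (use T in auto)

text \<open>The witness \<open>d\<close> is the diagonal of a triangular matrix similar to \<open>A\<close>; it lists the eigenvalues of
\<open>A\<close> with algebraic multiplicity. One list serves all powers at once, which gives both the spectral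
mapping property for powers and the power sums of the eigenvalues as traces.\<close>

lemma power_spectrum:
  assumes A: "A \<in> carrier_mat n n"
  shows "\<exists>d. (\<forall>k. char_poly (A ^\<^sub>m k) = (\<Prod>i\<leftarrow>[0..<n]. [:- (d i ^ k), 1:])) \<and>
             (\<forall>k. trace (A ^\<^sub>m k) = (\<Sum>i<n. d i ^ k))"
proof -
  obtain es where "char_poly A = (\<Prod>a\<leftarrow>es. [:- a, 1:])"
    using char_poly_factorized[OF A] by blast
  then obtain T where T: "T \<in> carrier_mat n n" "upper_triangular T" and sim: "similar_mat A T"
    using schur_decomposition_exists[OF A] by blast
  then obtain U V where wit: "similar_mat_wit A T U V"
    unfolding similar_mat_def by blast
  note UV = similar_mat_witD2[OF A wit]
  define d where "d i = T $$ (i,i)" for i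
  have Tk: "T ^\<^sub>m k \<in> carrier_mat n n" for k using T by simp
  note Tk_diag = upper_triangular_pow_diag[OF T]
  have "char_poly (A ^\<^sub>m k) = (\<Prod>i\<leftarrow>[0..<n]. [:- (d i ^ k), 1:])" for k
  proof -
    have "similar_mat (A ^\<^sub>m k) (T ^\<^sub>m k)"
      using similar_mat_wit_pow[OF wit] unfolding similar_mat_def by blast
    then have "char_poly (A ^\<^sub>m k) = (\<Prod>a\<leftarrow>diag_mat (T ^\<^sub>m k). [:- a, 1:])"
      using char_poly_similar char_poly_upper_triangular[OF Tk] Tk_diag by metis
    also have "diag_mat (T ^\<^sub>m k) = map (\<lambda>i. d i ^ k) [0..<n]"
      using Tk_diag T by (simp add: diag_mat_def d_def)
    finally show ?thesis by (simp add: o_def)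
  qed
  moreover have "trace (A ^\<^sub>m k) = (\<Sum>i<n. d i ^ k)" for k
  proof -
    have "trace (A ^\<^sub>m k) = trace (U * (T ^\<^sub>m k * V))"
      using similar_mat_wit_pow_id[OF wit] UV Tk by (simp add: assoc_mult_mat[of _ n n _ n _ n])
    also have "\<dots> = trace (T ^\<^sub>m k * V * U)"
      using UV Tk by (intro trace_mult_commute[of _ n n]) auto
    also have "T ^\<^sub>m k * V * U = T ^\<^sub>m k * (V * U)"
      by (rule assoc_mult_mat[OF Tk UV(7) UV(6)])
    also have "T ^\<^sub>m k * (V * U) = T ^\<^sub>m k"
      using UV Tk by simp
    also have "trace \<dots> = (\<Sum>i<n. d i ^ k)"
      using Tk_diag T by (simp add: trace_def d_def)
    finally show ?thesis .
  qed
  ultimately show ?thesis by blast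
qed

lemma eigenvalue_root_linear_factors:
  fixes A :: "complex mat"
  assumes "A \<in> carrier_mat n n" and "char_poly A = (\<Prod>i\<leftarrow>[0..<m]. [:- (d i), 1:])"
  shows "eigenvalue A \<mu> \<longleftrightarrow> (\<exists>i<m. \<mu> = d i)"
  using eigenvalue_root_char_poly[OF assms(1), of \<mu>]
  by (force simp: assms(2) poly_prod_list prod_list_zero_iff)

lemma eigenvalue_pow_obtain:
  fixes A :: "complex mat"
  assumes A: "A \<in> carrier_mat n n" and ev: "eigenvalue (A ^\<^sub>m k) \<nu>"
  obtains \<mu> where "eigenvalue A \<mu>" "\<nu> = \<mu> ^ k"
proof -
  obtain d where d: "\<And>k. char_poly (A ^\<^sub>m k) = (\<Prod>i\<leftarrow>[0..<n]. [:- (d i ^ k), 1:])"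
    using power_spectrum[OF A] by blast
  obtain i where "i < n" "\<nu> = d i ^ k"
    using eigenvalue_root_linear_factors[OF pow_carrier_mat[OF A] d] ev by blast
  moreover from this have "eigenvalue A (d i)"
    using eigenvalue_root_linear_factors[OF pow_carrier_mat[OF A] d, of 1 "d i"] A by auto
  ultimately show thesis using that by blast
qed

definition strictly_dominant :: "complex mat \<Rightarrow> complex \<Rightarrow> bool" where
  "strictly_dominant A l \<longleftrightarrow> (\<forall>\<mu>. eigenvalue A \<mu> \<longrightarrow> \<mu> = l \<or> cmod \<mu> < cmod l)"

text \<open>After scaling, the \<open>k\<close>-th trace is the sum of the \<open>k\<close>-th powers of all eigenvalues divided by \<open>l\<close>. The
copies of \<open>l\<close> contribute one each and all other terms vanish in the limit, so the limit of the traces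
counts the algebraic multiplicity of \<open>l\<close>.\<close>

lemma trace_pow_tendsto_order:
  assumes A: "A \<in> carrier_mat n n" and l: "l \<noteq> 0"
    and dom: "strictly_dominant A l"
  shows "(\<lambda>k. trace ((inverse l \<cdot>\<^sub>m A) ^\<^sub>m k)) \<longlonglongrightarrow> of_nat (order l (char_poly A))"
proof -
  obtain d where char: "\<And>k. char_poly (A ^\<^sub>m k) = (\<Prod>i\<leftarrow>[0..<n]. [:- (d i ^ k), 1:])"
    and tr: "\<And>k. trace (A ^\<^sub>m k) = (\<Sum>i<n. d i ^ k)"
    using power_spectrum[OF A] by blast
  have char1: "char_poly A = (\<Prod>i\<leftarrow>[0..<n]. [:- (d i), 1:])"
    using char[of 1] A by simp
  have d: "d i = l \<or> cmod (d i) < cmod l" if "i < n" for i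
    using dom eigenvalue_root_linear_factors[OF A char1] that
    unfolding strictly_dominant_def by blast
  have "order l (char_poly A) = (\<Sum>i\<leftarrow>[0..<n]. if d i = l then 1 else 0)"
    unfolding char1
    by (subst order_prod_list) (auto simp: o_def order_linear' intro!: arg_cong[of _ _ sum_list])
  also have "\<dots> = (\<Sum>i<n. if d i = l then 1 else 0)"
    by (simp add: sum_list_distinct_conv_sum_set lessThan_atLeast0 del: sum.delta)
  finally have ord: "order l (char_poly A) = (\<Sum>i<n. if d i = l then 1 else 0)" .
  have "trace ((inverse l \<cdot>\<^sub>m A) ^\<^sub>m k) = (\<Sum>i<n. (d i / l) ^ k)" for k
  proof -
    have "trace ((inverse l \<cdot>\<^sub>m A) ^\<^sub>m k) = inverse l ^ k * trace (A ^\<^sub>m k)"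
      unfolding pow_mat_smult[OF A] using A by (simp add: trace_def sum_distrib_left)
    also have "\<dots> = (\<Sum>i<n. (d i / l) ^ k)"
      by (simp add: tr sum_distrib_left divide_inverse power_inverse power_mult_distrib mult.commute)
    finally show ?thesis .
  qed
  moreover have "(\<lambda>k. \<Sum>i<n. (d i / l) ^ k) \<longlonglongrightarrow> (\<Sum>i<n. if d i = l then 1 else 0)"
  proof (intro tendsto_sum)
    fix i assume "i \<in> {..<n}"
    then have "d i = l \<or> cmod (d i / l) < 1"
      using d[of i] l by (auto simp: norm_divide)
    then show "(\<lambda>k. (d i / l) ^ k) \<longlonglongrightarrow> (if d i = l then 1 else 0)"
      using l by (auto intro: LIMSEQ_power_zero)
  qed
  ultimately show ?thesis by (simp add: ord of_nat_sum if_distrib cong: if_cong)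
qed

section \<open>Convergence of powers by deflation\<close>

lemma outer_carrier [simp]:
  "u \<in> carrier_vec n \<Longrightarrow> v \<in> carrier_vec m \<Longrightarrow> outer u v \<in> carrier_mat n m"
  by (simp add: outer_def)

lemma mult_mat_outer:
  assumes "M \<in> carrier_mat n m" "u \<in> carrier_vec m" "v \<in> carrier_vec l"
  shows "M * outer u v = outer (M *\<^sub>v u) v"
  by (rule eq_matI)
    (use assms in \<open>auto simp: outer_def scalar_prod_def sum_distrib_right mult.assoc intro!: sum.cong\<close>)

lemma mult_outer_mat:
  assumes "M \<in> carrier_mat m l" "u \<in> carrier_vec n" "v \<in> carrier_vec m"
  shows "outer u v * M = outer u (transpose_mat M *\<^sub>v v)"
  by (rule eq_matI)
    (use assms in \<open>auto simp: outer_def scalar_prod_def sum_distrib_left mult_ac intro!: sum.cong\<close>)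

lemma outer_mult_vec:
  assumes "u \<in> carrier_vec n" "v \<in> carrier_vec m" "w \<in> carrier_vec m"
  shows "outer u v *\<^sub>v w = (v \<bullet> w) \<cdot>\<^sub>v u"
  by (rule eq_vecI)
    (use assms in \<open>auto simp: outer_def scalar_prod_def sum_distrib_left mult_ac intro!: sum.cong\<close>)

text \<open>When \<open>x\<close> and \<open>y\<close> are right and left eigenvectors for a simple eigenvalue, this is the projection onto
the eigenspace along the sum of the other generalized eigenspaces.\<close>

definition spectral_projector :: "complex vec \<Rightarrow> complex vec \<Rightarrow> complex mat" where
  "spectral_projector x y = inverse (x \<bullet> y) \<cdot>\<^sub>m outer x y"

text \<open>The eigenvalue is scaled to one here, so that \<open>x\<close> and \<open>y\<close> are fixed by \<open>B\<close> and its transpose.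
Subtracting the projector \<open>L\<close> (deflation) replaces one copy of the eigenvalue one by zero and leaves
the rest of the spectrum alone.\<close>

context
  fixes B :: "complex mat" and x y :: "complex vec" and n :: nat and L :: "complex mat"
  defines "L \<equiv> spectral_projector x y"
  assumes B: "B \<in> carrier_mat n n" and x: "x \<in> carrier_vec n" and y: "y \<in> carrier_vec n"
    and Bx: "B *\<^sub>v x = x" and By: "transpose_mat B *\<^sub>v y = y" and xy: "x \<bullet> y \<noteq> 0"
begin

lemma projector_carrier: "L \<in> carrier_mat n n"
  using x y by (simp add: L_def spectral_projector_def)

lemma projector_mult_vec:
  assumes "w \<in> carrier_vec n"
  shows "L *\<^sub>v w = (y \<bullet> w / (x \<bullet> y)) \<cdot>\<^sub>v x"
proof -
  have "L *\<^sub>v w = inverse (x \<bullet> y) \<cdot>\<^sub>v (outer x y *\<^sub>v w)"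
    by (rule eq_vecI) (use x y assms in \<open>auto simp: L_def spectral_projector_def outer_def\<close>)
  then show ?thesis
    using outer_mult_vec[OF x y assms] by (simp add: smult_smult_assoc divide_inverse mult.commute)
qed

lemma projector_mult: "B * L = L" "L * B = L" "L * L = L"
proof -
  note c = outer_carrier[OF x y]
  show "B * L = L"
    unfolding L_def spectral_projector_def
    by (simp add: mult_smult_distrib[OF B c] mult_mat_outer[OF B x y] Bx)
  show "L * B = L"
    unfolding L_def spectral_projector_def
    by (simp add: mult_smult_assoc_mat[OF c B] mult_outer_mat[OF B x y] By)
  have "L * L = inverse (x \<bullet> y) \<cdot>\<^sub>m (L * outer x y)"
    unfolding L_def spectral_projector_def
    by (rule mult_smult_distrib[of _ n n]) (use c in auto)
  also have "L * outer x y = outer (L *\<^sub>v x) y"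
    by (rule mult_mat_outer[OF projector_carrier x y])
  also have "L *\<^sub>v x = x"
    using projector_mult_vec[OF x] comm_scalar_prod[OF x y] xy by simp
  finally show "L * L = L"
    by (simp add: L_def spectral_projector_def)
qed

lemma trace_projector: "trace L = 1"
proof -
  have "trace L = inverse (x \<bullet> y) * (x \<bullet> y)"
    using x y by (simp add: L_def spectral_projector_def trace_def outer_def scalar_prod_def
        sum_distrib_left lessThan_atLeast0)
  then show ?thesis using xy by simp
qed

lemma deflation_carrier: "B - L \<in> carrier_mat n n"
  using B projector_carrier by auto

text \<open>The products \<open>B L\<close>, \<open>L B\<close> and \<open>L L\<close> all equal \<open>L\<close>. The identity fails for the exponent zero.\<close>

lemma deflation_pow: "(B - L) ^\<^sub>m Suc k = B ^\<^sub>m Suc k - L"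
proof (induction k)
  case 0
  show ?case using B projector_carrier by auto
next
  case (Suc k)
  define M where "M = B ^\<^sub>m Suc k"
  have M: "M \<in> carrier_mat n n" unfolding M_def by (rule pow_carrier_mat[OF B])
  have "M * L = L"
    unfolding M_def
    by (induction k) (use B projector_carrier projector_mult in
      \<open>auto simp: assoc_mult_mat[of _ n n _ n _ n]\<close>)
  then have "(M - L) * (B - L) = (M * B - L) - (L - L)"
    using minus_mult_distrib_mat[OF M projector_carrier deflation_carrier]
      mult_minus_distrib_mat[OF M B projector_carrier]
      mult_minus_distrib_mat[OF projector_carrier B projector_carrier] projector_mult
    by simp
  also have "\<dots> = M * B - L"
    by (rule eq_matI) (use M B projector_carrier in auto)
  finally have "(M - L) * (B - L) = M * B - L" .
  then show ?case using Suc by (simp add: M_def)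
qed

text \<open>Pairing with \<open>y\<close> annihilates the range of \<open>B - L\<close>, so an eigenvector for a nonzero eigenvalue is
orthogonal to \<open>y\<close>; on such vectors \<open>L\<close> vanishes and \<open>B - L\<close> agrees with \<open>B\<close>.\<close>

lemma deflation_eigenvector:
  assumes ev: "eigenvector (B - L) v \<mu>" and mu: "\<mu> \<noteq> 0"
  shows "eigenvector B v \<mu>" and "y \<bullet> v = 0"
proof -
  have v: "v \<in> carrier_vec n" "v \<noteq> 0\<^sub>v n" and Cv: "(B - L) *\<^sub>v v = \<mu> \<cdot>\<^sub>v v"
    using ev deflation_carrier by (auto simp: eigenvector_def)
  have split: "(B - L) *\<^sub>v v = B *\<^sub>v v - (y \<bullet> v / (x \<bullet> y)) \<cdot>\<^sub>v x"
    using minus_mult_distrib_mat_vec[OF B projector_carrier v(1)] projector_mult_vec[OF v(1)] by simp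
  have "\<mu> * (y \<bullet> v) = y \<bullet> ((B - L) *\<^sub>v v)"
    unfolding Cv using v y by simp
  also have "\<dots> = y \<bullet> (B *\<^sub>v v) - (y \<bullet> v / (x \<bullet> y)) * (y \<bullet> x)"
    unfolding split using B v x y
    by (subst scalar_prod_minus_distrib[of _ n]) auto
  also have "y \<bullet> (B *\<^sub>v v) = y \<bullet> v"
    using transpose_vec_mult_scalar[OF B v(1) y] By by simp
  finally show yv: "y \<bullet> v = 0"
    using xy mu comm_scalar_prod[OF x y] by simp
  have "B *\<^sub>v v = (B - L) *\<^sub>v v"
    unfolding split using B v x by (intro eq_vecI) (auto simp: yv)
  then show "eigenvector B v \<mu>"
    using v B Cv by (simp add: eigenvector_def)
qed

lemma deflation_eigenvector_fixed:
  assumes "eigenvector B v 1" and "y \<bullet> v = 0"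
  shows "eigenvector (B - L) v 1"
proof -
  have v: "v \<in> carrier_vec n" "v \<noteq> 0\<^sub>v n" and Bv: "B *\<^sub>v v = v"
    using assms B by (auto simp: eigenvector_def)
  have "(B - L) *\<^sub>v v = v"
    using minus_mult_distrib_mat_vec[OF B projector_carrier v(1)] projector_mult_vec[OF v(1)] v x
      assms(2) Bv by (intro eq_vecI) auto
  then show ?thesis
    using v B projector_carrier by (simp add: eigenvector_def)
qed

text \<open>The excluded eigenvectors are exactly those that would survive in \<open>B - L\<close> with eigenvalue one; without
them \<open>B - L\<close> has spectral radius below one and its powers vanish in the limit.\<close>

lemma powers_tendsto_projector_if_no_fixed_vector:
  assumes n: "n > 0"
    and dom: "strictly_dominant B 1"
    and no_fixed: "\<And>v. eigenvector B v 1 \<Longrightarrow> y \<bullet> v \<noteq> 0"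
  shows "mat_tendsto (\<lambda>p. B ^\<^sub>m p) L"
proof -
  have small: "cmod \<mu> < 1" if "eigenvalue (B - L) \<mu>" for \<mu>
  proof (cases "\<mu> = 0")
    case False
    obtain v where "eigenvector (B - L) v \<mu>"
      using \<open>eigenvalue (B - L) \<mu>\<close> by (auto simp: eigenvalue_def)
    from deflation_eigenvector[OF this False] show ?thesis
      using dom no_fixed by (auto simp: strictly_dominant_def eigenvalue_def)
  qed simp
  have "(\<lambda>p. (B ^\<^sub>m p) $$ (i,j)) \<longlonglongrightarrow> L $$ (i,j)" if "i < n" "j < n" for i j
  proof -
    have "(\<lambda>p. ((B - L) ^\<^sub>m Suc p) $$ (i,j)) \<longlonglongrightarrow> 0"
      using powers_tendsto_zero[OF deflation_carrier n small that] by (rule LIMSEQ_Suc)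
    then have "(\<lambda>p. (B ^\<^sub>m Suc p) $$ (i,j) - L $$ (i,j)) \<longlonglongrightarrow> 0"
      unfolding deflation_pow using B projector_carrier that by (simp del: pow_mat.simps)
    then show ?thesis
      using LIM_zero_iff LIMSEQ_imp_Suc by blast
  qed
  then show ?thesis
    using B projector_carrier by (simp add: mat_tendsto_def)
qed

text \<open>Since \<open>L\<close> has trace one, the traces of the powers of \<open>B - L\<close> tend to zero. That limit is the
multiplicity of one as an eigenvalue of \<open>B - L\<close>. Counting by traces avoids relating geometric to
algebraic multiplicities.\<close>

lemma powers_tendsto_projector_if_trace:
  assumes n: "n > 0"
    and dom: "strictly_dominant B 1"
    and tr: "(\<lambda>p. trace (B ^\<^sub>m p)) \<longlonglongrightarrow> 1"
  shows "mat_tendsto (\<lambda>p. B ^\<^sub>m p) L"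
proof (rule powers_tendsto_projector_if_no_fixed_vector[OF n dom])
  fix v assume ev: "eigenvector B v 1"
  let ?C = "B - L"
  have C: "?C \<in> carrier_mat n n" by (rule deflation_carrier)
  have "\<mu> = 1 \<or> cmod \<mu> < cmod 1" if "eigenvalue ?C \<mu>" for \<mu>
    using that deflation_eigenvector(1) dom
    by (cases "\<mu> = 0") (auto simp: strictly_dominant_def eigenvalue_def)
  then have "strictly_dominant ?C 1"
    by (simp add: strictly_dominant_def)
  then have "(\<lambda>p. trace ((inverse 1 \<cdot>\<^sub>m ?C) ^\<^sub>m p)) \<longlonglongrightarrow> of_nat (order 1 (char_poly ?C))"
    by (intro trace_pow_tendsto_order[OF C]) auto
  moreover have "inverse 1 \<cdot>\<^sub>m ?C = ?C"
    by (rule eq_matI) auto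
  ultimately have lim: "(\<lambda>p. trace (?C ^\<^sub>m Suc p)) \<longlonglongrightarrow> of_nat (order 1 (char_poly ?C))"
    by (intro LIMSEQ_Suc) simp
  have deflated: "trace (?C ^\<^sub>m Suc p) = trace (B ^\<^sub>m Suc p) - 1" for p
  proof -
    have "trace (?C ^\<^sub>m Suc p) = trace (B ^\<^sub>m Suc p) - trace L"
      unfolding deflation_pow using B projector_carrier by (simp add: trace_def sum_subtractf)
    then show ?thesis using trace_projector by simp
  qed
  have "(\<lambda>p. trace (B ^\<^sub>m Suc p) - 1) \<longlonglongrightarrow> 1 - 1"
    by (intro tendsto_diff tendsto_const LIMSEQ_Suc[OF tr])
  then have "of_nat (order 1 (char_poly ?C)) = (1 - 1 :: complex)"
    using lim unfolding deflated by (rule LIMSEQ_unique[symmetric])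
  moreover have "char_poly ?C \<noteq> 0"
    using degree_monic_char_poly[OF C] n by auto
  ultimately have "\<not> eigenvalue ?C 1"
    by (metis eigenvalue_root_char_poly[OF C] order_root of_nat_eq_0_iff diff_self)
  then show "y \<bullet> v \<noteq> 0"
    using deflation_eigenvector_fixed[OF ev] by (auto simp: eigenvalue_def)
qed

lemma trace_tendsto_if_powers_tendsto_projector:
  assumes "mat_tendsto (\<lambda>p. B ^\<^sub>m p) L"
  shows "(\<lambda>p. trace (B ^\<^sub>m p)) \<longlonglongrightarrow> 1"
proof -
  have "(\<lambda>p. \<Sum>i<n. (B ^\<^sub>m p) $$ (i,i)) \<longlonglongrightarrow> (\<Sum>i<n. L $$ (i,i))"
    using assms projector_carrier by (intro tendsto_sum) (auto simp: mat_tendsto_def)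
  then show ?thesis
    using trace_projector B projector_carrier by (simp add: trace_def)
qed

end

section \<open>Similarity to a weakly doubly stochastic matrix\<close>

text \<open>The outer product \<open>E\<close> satisfies \<open>E E = (v \<bullet> u) E\<close>, so the span of the identity and \<open>E\<close> is a commutative
algebra with this multiplication rule.\<close>

lemma diag_plus_rank_one_mult:
  fixes a b a' b' :: complex
  assumes u: "u \<in> carrier_vec n" and v: "v \<in> carrier_vec n"
  shows "(a \<cdot>\<^sub>m 1\<^sub>m n + b \<cdot>\<^sub>m outer u v) * (a' \<cdot>\<^sub>m 1\<^sub>m n + b' \<cdot>\<^sub>m outer u v) =
    (a * a') \<cdot>\<^sub>m 1\<^sub>m n + (a * b' + b * a' + b * b' * (v \<bullet> u)) \<cdot>\<^sub>m outer u v" (is "?M * ?N = ?R")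
proof -
  let ?E = "outer u v" and ?I = "1\<^sub>m n :: complex mat"
  have E: "?E \<in> carrier_mat n n" using u v by simp
  have I: "?I \<in> carrier_mat n n" by simp
  have N: "?N \<in> carrier_mat n n" using E by simp
  have EE: "?E * ?E = (v \<bullet> u) \<cdot>\<^sub>m ?E"
    using mult_mat_outer[OF E u v] outer_mult_vec[OF u v u]
    by (auto simp: outer_def intro!: eq_matI)
  have "?E * ?N = ?E * (a' \<cdot>\<^sub>m ?I) + ?E * (b' \<cdot>\<^sub>m ?E)"
    by (rule mult_add_distrib_mat[OF E]) (use E in auto)
  also have "\<dots> = a' \<cdot>\<^sub>m ?E + b' \<cdot>\<^sub>m ((v \<bullet> u) \<cdot>\<^sub>m ?E)"
    using E by (simp add: mult_smult_distrib[OF E I] mult_smult_distrib[OF E E] EE)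
  finally have EN: "?E * ?N = a' \<cdot>\<^sub>m ?E + b' \<cdot>\<^sub>m ((v \<bullet> u) \<cdot>\<^sub>m ?E)" .
  have "?M * ?N = (a \<cdot>\<^sub>m ?I) * ?N + (b \<cdot>\<^sub>m ?E) * ?N"
    by (rule add_mult_distrib_mat[of _ n n _ _ n]) (use E N in auto)
  also have "\<dots> = a \<cdot>\<^sub>m ?N + b \<cdot>\<^sub>m (?E * ?N)"
    using N by (simp only: mult_smult_assoc_mat[OF I N] mult_smult_assoc_mat[OF E N] left_mult_one_mat[OF N])
  also have "\<dots> = ?R"
    unfolding EN using E by (intro eq_matI) (auto simp: algebra_simps)
  finally show ?thesis .
qed

lemma sherman_morrison_inverse:
  fixes t :: complex
  assumes u: "u \<in> carrier_vec n" and v: "v \<in> carrier_vec n"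
    and t: "t \<noteq> 0" and tuv: "t + v \<bullet> u \<noteq> 0"
  shows "\<exists>T \<in> carrier_mat n n.
    (t \<cdot>\<^sub>m 1\<^sub>m n + outer u v) * T = 1\<^sub>m n \<and> T * (t \<cdot>\<^sub>m 1\<^sub>m n + outer u v) = 1\<^sub>m n"
proof -
  define d where "d = - inverse (t * (t + v \<bullet> u))"
  let ?E = "outer u v" and ?I = "1\<^sub>m n :: complex mat"
  let ?T = "inverse t \<cdot>\<^sub>m ?I + d \<cdot>\<^sub>m ?E"
  have E: "?E \<in> carrier_mat n n" using u v by simp
  have "d * (t + v \<bullet> u) = - inverse t"
    using tuv by (simp add: d_def inverse_mult_distrib mult.assoc)
  then have d: "t * d + 1 * inverse t + 1 * d * (v \<bullet> u) = 0"
    by (simp add: algebra_simps)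
  have S: "t \<cdot>\<^sub>m ?I + ?E = t \<cdot>\<^sub>m ?I + 1 \<cdot>\<^sub>m ?E"
    by (rule eq_matI) auto
  have one: "1 \<cdot>\<^sub>m ?I + 0 \<cdot>\<^sub>m ?E = ?I"
    by (rule eq_matI) (use E in auto)
  have "(t \<cdot>\<^sub>m ?I + ?E) * ?T = 1 \<cdot>\<^sub>m ?I + 0 \<cdot>\<^sub>m ?E"
    unfolding S diag_plus_rank_one_mult[OF u v] d using t by simp
  moreover have "?T * (t \<cdot>\<^sub>m ?I + ?E) = 1 \<cdot>\<^sub>m ?I + 0 \<cdot>\<^sub>m ?E"
    unfolding S diag_plus_rank_one_mult[OF u v] using t d by (simp add: algebra_simps)
  ultimately show ?thesis
    unfolding one by (intro bexI[of _ ?T]) (use E in auto)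
qed

lemma transpose_mult_vec_one:
  assumes S: "S \<in> carrier_mat n n" and "i < n"
  shows "(transpose_mat S *\<^sub>v vec n (\<lambda>_. 1)) $ i = (\<Sum>j<n. S $$ (j,i) :: complex)"
  using assms by (subst mult_mat_vec_sum[of _ n n]) auto

text \<open>It suffices that \<open>S\<close> carries \<open>x\<close> to \<open>e\<close> and its transpose carries \<open>e\<close> to \<open>y\<close>: then conjugation by \<open>S\<close>
turns the fixed vectors \<open>x\<close> and \<open>y\<close> of \<open>B\<close> and its transpose into \<open>e\<close>.\<close>

lemma transform_to_weakly_doubly_stochastic:
  fixes B :: "complex mat" and e :: "complex vec" and n :: nat
  defines "e \<equiv> vec n (\<lambda>_. 1)"
  assumes B: "B \<in> carrier_mat n n" and S: "S \<in> carrier_mat n n" and T: "T \<in> carrier_mat n n"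
    and ST: "S * T = 1\<^sub>m n" and TS: "T * S = 1\<^sub>m n"
    and x: "x \<in> carrier_vec n" and y: "y \<in> carrier_vec n"
    and Bx: "B *\<^sub>v x = x" and By: "transpose_mat B *\<^sub>v y = y"
    and Sx: "S *\<^sub>v x = e" and Sy: "transpose_mat S *\<^sub>v e = y"
  shows "weakly_doubly_stochastic (S * B * T)" and "similar_mat_wit (S * B * T) B S T"
proof -
  let ?C = "S * B * T"
  have e: "e \<in> carrier_vec n" by (simp add: e_def)
  have C: "?C \<in> carrier_mat n n" using B S T by simp
  have "T *\<^sub>v e = (T * S) *\<^sub>v x"
    using assoc_mult_mat_vec[OF T S x] Sx by simp
  then have Te: "T *\<^sub>v e = x" using TS x by simp
  have "transpose_mat T *\<^sub>v y = (transpose_mat T * transpose_mat S) *\<^sub>v e"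
    using assoc_mult_mat_vec[of "transpose_mat T" n n "transpose_mat S" n e] S T e Sy by simp
  also have "transpose_mat T * transpose_mat S = 1\<^sub>m n"
    using transpose_mult[OF S T] ST by simp
  finally have Ty: "transpose_mat T *\<^sub>v y = e" using e by simp
  have "?C *\<^sub>v e = S *\<^sub>v (B *\<^sub>v (T *\<^sub>v e))"
    using assoc_mult_mat_vec[of "S * B" n n T n e] assoc_mult_mat_vec[of S n n B n "T *\<^sub>v e"] B S T e
    by simp
  also have "\<dots> = e" by (simp add: Te Bx Sx)
  finally have Ce: "?C *\<^sub>v e = e" .
  have "transpose_mat ?C = transpose_mat T * (transpose_mat B * transpose_mat S)"
    using transpose_mult[of "S * B" n n T n] transpose_mult[OF S B] S B T by simp
  also have "\<dots> *\<^sub>v e = transpose_mat T *\<^sub>v (transpose_mat B *\<^sub>v (transpose_mat S *\<^sub>v e))"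
    using assoc_mult_mat_vec[of "transpose_mat T" n n "transpose_mat B * transpose_mat S" n e]
      assoc_mult_mat_vec[of "transpose_mat B" n n "transpose_mat S" n e] B S T e
    by simp
  also have "\<dots> = e" by (simp add: Sy By Ty)
  finally have Cte: "transpose_mat ?C *\<^sub>v e = e" .
  show "weakly_doubly_stochastic ?C"
    using Ce Cte C S T unfolding weakly_doubly_stochastic_def Let_def e_def by simp
  show "similar_mat_wit ?C B S T"
    by (rule similar_mat_witI[OF ST TS refl C B S T])
qed

text \<open>Put \<open>S = t I + u v\<^sup>T\<close>. The requirements \<open>S x = e\<close> and \<open>S\<^sup>T e = y\<close> determine \<open>u\<close> and \<open>v\<close> up to a scalar:
\<open>u\<close> is parallel to \<open>e - t x\<close> and \<open>v\<close> to \<open>y - t e\<close>. They are compatible because \<open>x \<bullet> y = n = e \<bullet> e\<close>, and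
the common scale is \<open>q = n - t (\<Sum> x)\<close>. The quantity that decides invertibility is
\<open>t + v \<bullet> u = ((\<Sum> y) - t n) / q\<close>; this accounts for the two values that \<open>t\<close> must avoid.\<close>

lemma weakly_doubly_stochastic_via_dpr1:
  assumes B: "B \<in> carrier_mat n n" and x: "x \<in> carrier_vec n" and y: "y \<in> carrier_vec n"
    and Bx: "B *\<^sub>v x = x" and By: "transpose_mat B *\<^sub>v y = y"
    and xy: "x \<bullet> y = of_nat n"
    and t: "t \<noteq> 0" "t * (\<Sum>i<n. x $ i) \<noteq> of_nat n" "(\<Sum>i<n. y $ i) \<noteq> t * of_nat n"
  shows "\<exists>C. weakly_doubly_stochastic C \<and> dpr1_similar B C"
proof -
  define X where "X = (\<Sum>i<n. x $ i)"
  define Y where "Y = (\<Sum>i<n. y $ i)"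
  define q where "q = of_nat n - t * X"
  define u where "u = vec n (\<lambda>i. 1 - t * x $ i)"
  define v where "v = vec n (\<lambda>j. (y $ j - t) / q)"
  let ?e = "vec n (\<lambda>_. 1) :: complex vec"
  define S where "S = t \<cdot>\<^sub>m 1\<^sub>m n + outer u v"
  have q: "q \<noteq> 0" using t(2) by (simp add: q_def X_def)
  have u: "u \<in> carrier_vec n" and v: "v \<in> carrier_vec n" by (simp_all add: u_def v_def)
  have S: "S \<in> carrier_mat n n" using outer_carrier[OF u v] by (simp add: S_def)
  have S_index: "S $$ (i,j) = (if i = j then t else 0) + (1 - t * x $ i) * ((y $ j - t) / q)"
    if "i < n" "j < n" for i j
    using that by (simp add: S_def outer_def u_def v_def)
  have xy_sum: "(\<Sum>i<n. x $ i * y $ i) = of_nat n"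
    using xy x y by (simp add: scalar_prod_def lessThan_atLeast0)
  have vx: "(\<Sum>j<n. (y $ j - t) / q * x $ j) = 1"
  proof -
    have "(\<Sum>j<n. (y $ j - t) / q * x $ j) = (\<Sum>j<n. x $ j * y $ j - t * x $ j) / q"
      by (simp add: sum_divide_distrib algebra_simps)
    also have "(\<Sum>j<n. x $ j * y $ j - t * x $ j) = q"
      by (simp add: sum_subtractf xy_sum q_def X_def sum_distrib_left)
    finally show ?thesis using q by simp
  qed
  have u_sum: "(\<Sum>i<n. 1 - t * x $ i) = q"
    by (simp add: sum_subtractf q_def X_def sum_distrib_left)
  have "S *\<^sub>v x = ?e"
  proof (rule eq_vecI)
    fix i assume "i < dim_vec ?e"
    then have i: "i < n" by simp
    have "(S *\<^sub>v x) $ i = (\<Sum>j<n. S $$ (i,j) * x $ j)"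
      by (rule mult_mat_vec_sum[OF S x i])
    also have "\<dots> = (\<Sum>j<n. (if i = j then t * x $ j else 0) + (1 - t * x $ i) * ((y $ j - t) / q * x $ j))"
      using i by (intro sum.cong) (auto simp: S_index algebra_simps)
    also have "\<dots> = t * x $ i + (1 - t * x $ i) * (\<Sum>j<n. (y $ j - t) / q * x $ j)"
      using i by (simp add: sum.distrib sum_distrib_left)
    also have "\<dots> = ?e $ i" unfolding vx using i by simp
    finally show "(S *\<^sub>v x) $ i = ?e $ i" .
  qed (use S in simp)
  moreover have "transpose_mat S *\<^sub>v ?e = y"
  proof (rule eq_vecI)
    fix i assume "i < dim_vec y"
    then have i: "i < n" using y by simp
    have "(transpose_mat S *\<^sub>v ?e) $ i = (\<Sum>j<n. S $$ (j,i))"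
      by (rule transpose_mult_vec_one[OF S i])
    also have "\<dots> = (\<Sum>j<n. (if j = i then t else 0) + (1 - t * x $ j) * ((y $ i - t) / q))"
      using i by (intro sum.cong) (auto simp: S_index)
    also have "\<dots> = t + (\<Sum>j<n. 1 - t * x $ j) * ((y $ i - t) / q)"
      using i by (simp only: sum.distrib sum_distrib_right) simp
    finally show "(transpose_mat S *\<^sub>v ?e) $ i = y $ i"
      using q by (simp add: u_sum)
  qed (use S y in simp)
  moreover have "t + v \<bullet> u \<noteq> 0"
  proof -
    have "v \<bullet> u = (\<Sum>j<n. (y $ j - t) / q - t * ((y $ j - t) / q * x $ j))"
      by (simp add: scalar_prod_def u_def v_def lessThan_atLeast0 algebra_simps
          diff_divide_distrib add_divide_distrib)
    also have "\<dots> = (\<Sum>j<n. (y $ j - t) / q) - t"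
      by (simp only: sum_subtractf vx mult_1_right flip: sum_distrib_left)
    also have "(\<Sum>j<n. (y $ j - t) / q) = (Y - t * of_nat n) / q"
      by (simp add: sum_subtractf Y_def mult.commute flip: sum_divide_distrib)
    finally show ?thesis using t(3) q by (simp add: Y_def)
  qed
  ultimately obtain T where T: "T \<in> carrier_mat n n" "S * T = 1\<^sub>m n" "T * S = 1\<^sub>m n"
    and fixed: "S *\<^sub>v x = ?e" "transpose_mat S *\<^sub>v ?e = y"
    using sherman_morrison_inverse[OF u v t(1)] unfolding S_def by blast
  have "diag_plus_rank_one n S"
    unfolding diag_plus_rank_one_def
    by (intro exI[of _ "t \<cdot>\<^sub>m 1\<^sub>m n"] exI[of _ u] exI[of _ v]) (use u v in \<open>auto simp: S_def diagonal_mat_def\<close>)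
  then show ?thesis
    using transform_to_weakly_doubly_stochastic[OF B S T(1,2,3) x y Bx By fixed] B
    unfolding dpr1_similar_def by auto
qed

section \<open>Positive eigenvectors and convergence\<close>

lemma pos_complex_iff: "pos_complex z \<longleftrightarrow> (\<exists>r>0. z = complex_of_real r)"
  by (auto simp: pos_complex_def Reals_def)

lemma pos_complex_nonzero: "pos_complex z \<Longrightarrow> z \<noteq> 0"
  by (auto simp: pos_complex_def)

lemma pos_complex_mult: "pos_complex a \<Longrightarrow> pos_complex b \<Longrightarrow> pos_complex (a * b)"
  unfolding pos_complex_iff by (metis mult_pos_pos of_real_mult)

lemma pos_complex_inverse: "pos_complex a \<Longrightarrow> pos_complex (inverse a)"
  unfolding pos_complex_iff by (metis positive_imp_inverse_positive of_real_inverse)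

lemma pos_complex_sum:
  assumes "finite I" "I \<noteq> {}" "\<And>i. i \<in> I \<Longrightarrow> pos_complex (f i)"
  shows "pos_complex (\<Sum>i\<in>I. f i)"
  using assms unfolding pos_complex_def by (auto intro: sum_in_Reals sum_pos)

lemma pos_vec_scalar_prod:
  assumes "x \<in> carrier_vec n" "y \<in> carrier_vec n" "pos_vec x" "pos_vec y" "n > 0"
  shows "pos_complex (x \<bullet> y)"
  using assms unfolding scalar_prod_def pos_vec_def
  by (intro pos_complex_sum) (auto intro!: pos_complex_mult)

lemma pos_mat_spectral_projector:
  assumes "x \<in> carrier_vec n" "y \<in> carrier_vec n" "pos_vec x" "pos_vec y" "n > 0"
  shows "pos_mat (spectral_projector x y)"
  using assms pos_vec_scalar_prod[OF assms]
  by (auto simp: pos_mat_def spectral_projector_def outer_def pos_vec_def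
      intro!: pos_complex_mult pos_complex_inverse)

lemma scale_eigenvector_to_fixed:
  assumes A: "A \<in> carrier_mat n n" and l: "(l::complex) \<noteq> 0" and ev: "eigenvector A x l"
  shows "(inverse l \<cdot>\<^sub>m A) *\<^sub>v x = x"
proof -
  have "eigenvector (inverse l \<cdot>\<^sub>m A) x (inverse l * l)"
    using eigenvector_smult_iff[OF A, of "inverse l" x l] ev l by simp
  then show ?thesis using l by (simp add: eigenvector_def)
qed

lemma pos_eigenvectorsD:
  assumes A: "A \<in> carrier_mat n n" and ev: "pos_eigenvectors A l x y"
  shows "x \<in> carrier_vec n" "y \<in> carrier_vec n" "pos_vec x" "pos_vec y"
    and "eigenvector A x l" "eigenvector (transpose_mat A) y l"
  using assms by (auto simp: pos_eigenvectors_def left_eigenvector_def eigenvector_def)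

lemma pos_eigenvectors_scaled:
  assumes A: "A \<in> carrier_mat n n" and n: "n > 0" and l: "l \<noteq> 0"
    and ev: "pos_eigenvectors A l x y"
  shows "(inverse l \<cdot>\<^sub>m A) *\<^sub>v x = x" "transpose_mat (inverse l \<cdot>\<^sub>m A) *\<^sub>v y = y" "x \<bullet> y \<noteq> 0"
proof -
  note xy = pos_eigenvectorsD[OF A ev]
  show "(inverse l \<cdot>\<^sub>m A) *\<^sub>v x = x"
    by (rule scale_eigenvector_to_fixed[OF A l xy(5)])
  have "transpose_mat (inverse l \<cdot>\<^sub>m A) = inverse l \<cdot>\<^sub>m transpose_mat A"
    by (rule eq_matI) auto
  then show "transpose_mat (inverse l \<cdot>\<^sub>m A) *\<^sub>v y = y"
    using scale_eigenvector_to_fixed[OF _ l xy(6)] A by simp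
  show "x \<bullet> y \<noteq> 0"
    using pos_vec_scalar_prod[OF xy(1-4) n] by (rule pos_complex_nonzero)
qed

lemma strictly_dominant_scaled:
  assumes A: "A \<in> carrier_mat n n" and l: "l \<noteq> 0" and dom: "strictly_dominant A l"
  shows "strictly_dominant (inverse l \<cdot>\<^sub>m A) 1"
  unfolding strictly_dominant_def
proof (intro allI impI)
  fix \<nu> assume "eigenvalue (inverse l \<cdot>\<^sub>m A) \<nu>"
  then obtain v where "eigenvector (inverse l \<cdot>\<^sub>m A) v \<nu>"
    by (auto simp: eigenvalue_def)
  then have "eigenvector A v (l * \<nu>)"
    using eigenvector_smult_iff[OF A, of "inverse l" v "l * \<nu>"] l by (simp flip: mult.assoc)
  then have "l * \<nu> = l \<or> cmod (l * \<nu>) < cmod l"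
    using dom by (auto simp: strictly_dominant_def eigenvalue_def)
  then show "\<nu> = 1 \<or> cmod \<nu> < cmod 1" using l by (simp add: norm_mult)
qed

text \<open>Both sides say that the traces of the scaled powers tend to one.\<close>

lemma powers_tendsto_iff_simple:
  assumes A: "A \<in> carrier_mat n n" and n: "n > 0" and l: "l \<noteq> 0" and dom: "strictly_dominant A l"
    and ev: "pos_eigenvectors A l x y"
  shows "mat_tendsto (\<lambda>p. (inverse l \<cdot>\<^sub>m A) ^\<^sub>m p) (spectral_projector x y)
    \<longleftrightarrow> order l (char_poly A) = 1"
proof -
  let ?B = "inverse l \<cdot>\<^sub>m A"
  have B: "?B \<in> carrier_mat n n" using A by simp
  note xy = pos_eigenvectorsD(1,2)[OF A ev] pos_eigenvectors_scaled[OF A n l ev]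
  note tr = trace_pow_tendsto_order[OF A l dom]
  show ?thesis
  proof
    assume "mat_tendsto (\<lambda>p. ?B ^\<^sub>m p) (spectral_projector x y)"
    from LIMSEQ_unique[OF tr trace_tendsto_if_powers_tendsto_projector[OF B xy this]]
    show "order l (char_poly A) = 1" by (metis of_nat_1 of_nat_eq_iff)
  next
    assume "order l (char_poly A) = 1"
    then show "mat_tendsto (\<lambda>p. ?B ^\<^sub>m p) (spectral_projector x y)"
      using powers_tendsto_projector_if_trace[OF B xy n strictly_dominant_scaled[OF A l dom]] tr
      by simp
  qed
qed

lemma convergent_unimodular_powers:
  fixes z :: complex
  assumes "cmod z = 1" and lim: "(\<lambda>p. z ^ p) \<longlonglongrightarrow> m"
  shows "z = 1"
proof -
  have "(\<lambda>p. z * z ^ p) \<longlonglongrightarrow> z * m" using lim by (intro tendsto_intros)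
  moreover have "(\<lambda>p. z * z ^ p) \<longlonglongrightarrow> m" using LIMSEQ_Suc[OF lim] by simp
  ultimately have "z * m = m" by (rule LIMSEQ_unique)
  moreover have "cmod m = 1"
    using tendsto_norm[OF lim] assms(1) by (simp add: norm_power LIMSEQ_const_iff)
  ultimately show ?thesis by auto
qed

text \<open>On an eigenvector for \<open>\<mu>\<close> the scaled powers act as \<open>(\<mu> / l) ^ p\<close>, and powers of a unimodular number
converge only if that number is one.\<close>

lemma strictly_dominant_if_powers_converge:
  assumes A: "A \<in> carrier_mat n n" and l: "l \<noteq> 0"
    and max: "\<And>\<mu>. eigenvalue A \<mu> \<Longrightarrow> cmod \<mu> \<le> cmod l"
    and L: "L \<in> carrier_mat n n" and lim: "mat_tendsto (\<lambda>p. (inverse l \<cdot>\<^sub>m A) ^\<^sub>m p) L"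
  shows "strictly_dominant A l"
  unfolding strictly_dominant_def
proof (intro allI impI)
  fix \<mu> assume "eigenvalue A \<mu>"
  then obtain v where v: "eigenvector A v \<mu>" by (auto simp: eigenvalue_def)
  show "\<mu> = l \<or> cmod \<mu> < cmod l"
  proof (cases "cmod \<mu> = cmod l")
    case True
    let ?B = "inverse l \<cdot>\<^sub>m A"
    have B: "?B \<in> carrier_mat n n" using A by simp
    have Bv: "eigenvector ?B v (\<mu> / l)"
      using v eigenvector_smult_iff[OF A, of "inverse l" v \<mu>] l by (simp add: divide_inverse mult.commute)
    have vc: "v \<in> carrier_vec n" and "v \<noteq> 0\<^sub>v n" using v A by (auto simp: eigenvector_def)
    then obtain i where i: "i < n" "v $ i \<noteq> 0" by (auto simp: vec_eq_iff)
    have "(\<lambda>p. \<Sum>j<n. (?B ^\<^sub>m p) $$ (i,j) * v $ j) \<longlonglongrightarrow> (\<Sum>j<n. L $$ (i,j) * v $ j)"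
      using lim L i by (intro tendsto_sum tendsto_mult_right) (auto simp: mat_tendsto_def)
    moreover have "(\<Sum>j<n. (?B ^\<^sub>m p) $$ (i,j) * v $ j) = (\<mu> / l) ^ p * v $ i" for p
      using mult_mat_vec_sum[OF pow_carrier_mat[OF B] vc i(1), of p] eigenvector_pow[OF B Bv, of p] vc i
      by simp
    ultimately have "(\<lambda>p. (\<mu> / l) ^ p * v $ i / v $ i) \<longlonglongrightarrow> (\<Sum>j<n. L $$ (i,j) * v $ j) / v $ i"
      using i by (intro tendsto_divide) auto
    then have "(\<lambda>p. (\<mu> / l) ^ p) \<longlonglongrightarrow> (\<Sum>j<n. L $$ (i,j) * v $ j) / v $ i"
      using i by simp
    then have "\<mu> / l = 1"
      using True l by (intro convergent_unimodular_powers) (auto simp: norm_divide)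
    then show ?thesis using l by simp
  next
    case False
    then show ?thesis using max[OF \<open>eigenvalue A \<mu>\<close>] by simp
  qed
qed

lemma powers_limit_nonzero_eigenvalue:
  assumes A: "A \<in> carrier_mat n n" and n: "n > 0"
    and L: "L \<in> carrier_mat n n" "pos_mat L"
    and lim: "mat_tendsto (\<lambda>p. (inverse l \<cdot>\<^sub>m A) ^\<^sub>m p) L"
  shows "l \<noteq> 0"
proof
  assume "l = 0"
  then have "((inverse l \<cdot>\<^sub>m A) ^\<^sub>m Suc p) $$ (0,0) = 0" for p
    unfolding pow_mat_smult[OF A] using A n by (simp del: pow_mat.simps)
  moreover have "(\<lambda>p. ((inverse l \<cdot>\<^sub>m A) ^\<^sub>m Suc p) $$ (0,0)) \<longlonglongrightarrow> L $$ (0,0)"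
    using lim L n by (intro LIMSEQ_Suc) (auto simp: mat_tendsto_def)
  ultimately have "L $$ (0,0) = 0" by (simp add: LIMSEQ_const_iff)
  then show False using L n pos_complex_nonzero by (auto simp: pos_mat_def)
qed

section \<open>Power positive matrices\<close>

lemma power_positive_transpose:
  assumes A: "A \<in> carrier_mat n n" and "power_positive A"
  shows "power_positive (transpose_mat A)"
proof -
  obtain k where k: "k \<ge> 1" "pos_mat (A ^\<^sub>m k)"
    using assms by (auto simp: power_positive_def)
  then have "pos_mat (transpose_mat A ^\<^sub>m k)"
    unfolding pow_mat_transpose[OF A] by (auto simp: pos_mat_def)
  then show ?thesis using k by (auto simp: power_positive_def)
qed

text \<open>An eigenvector of \<open>A\<close> is also one of the positive power of \<open>A\<close>, again for an eigenvalue of maximal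
modulus, hence a multiple of a positive vector. That vector is still an eigenvector of \<open>A\<close> itself,
which spares any comparison of the eigenspaces of \<open>A\<close> and its power.\<close>

lemma power_positive_peripheral_eigenvector:
  assumes A: "A \<in> carrier_mat n n" and n: "n > 0" and pp: "power_positive A"
    and ev: "eigenvector A v \<mu>"
    and max: "\<And>\<nu>. eigenvalue A \<nu> \<Longrightarrow> cmod \<nu> \<le> cmod \<mu>"
  shows "\<exists>c w. c \<noteq> 0 \<and> pos_vec w \<and> eigenvector A w \<mu> \<and> v = c \<cdot>\<^sub>v w"
proof -
  obtain k where k: "k \<ge> 1" "pos_mat (A ^\<^sub>m k)"
    using pp by (auto simp: power_positive_def)
  have v: "v \<in> carrier_vec n" "v \<noteq> 0\<^sub>v n" "A *\<^sub>v v = \<mu> \<cdot>\<^sub>v v"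
    using ev A by (auto simp: eigenvector_def)
  have "eigenvector (A ^\<^sub>m k) v (\<mu> ^ k)"
    using eigenvector_pow[OF A ev, of k] v A by (simp add: eigenvector_def)
  moreover have "cmod \<nu> \<le> cmod (\<mu> ^ k)" if \<nu>: "eigenvalue (A ^\<^sub>m k) \<nu>" for \<nu>
  proof -
    obtain \<nu>' where "eigenvalue A \<nu>'" "\<nu> = \<nu>' ^ k"
      by (rule eigenvalue_pow_obtain[OF A \<nu>])
    then show ?thesis using max by (simp add: norm_power power_mono)
  qed
  ultimately obtain c w where cw: "c \<noteq> 0" "w \<in> carrier_vec n" "pos_vec w" "v = c \<cdot>\<^sub>v w"
    using peripheral_eigenvector_positive[OF pow_carrier_mat[OF A] n k(2)] by blast
  have "w = inverse c \<cdot>\<^sub>v v"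
    using cw by (auto simp: vec_eq_iff)
  then have "A *\<^sub>v w = \<mu> \<cdot>\<^sub>v w"
    using mult_mat_vec[OF A v(1)] v(3) by (simp add: smult_smult_assoc mult.commute)
  moreover have "w \<noteq> 0\<^sub>v n" using v(2) cw by (auto simp: vec_eq_iff)
  ultimately show ?thesis
    using cw A by (auto simp: eigenvector_def)
qed

text \<open>Applied to positive \<open>x\<close> and \<open>y\<close>, this excludes several eigenvalues on the circle of maximal modulus.\<close>

lemma left_right_eigenvalues_agree:
  fixes A :: "complex mat"
  assumes A: "A \<in> carrier_mat n n"
    and x: "eigenvector A x \<mu>" and y: "eigenvector (transpose_mat A) y \<nu>" and xy: "y \<bullet> x \<noteq> 0"
  shows "\<mu> = \<nu>"
proof -
  have c: "x \<in> carrier_vec n" "y \<in> carrier_vec n" using x y A by (auto simp: eigenvector_def)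
  have "\<nu> * (y \<bullet> x) = (transpose_mat A *\<^sub>v y) \<bullet> x"
    using y c by (simp add: eigenvector_def)
  also have "\<dots> = y \<bullet> (A *\<^sub>v x)" by (rule transpose_vec_mult_scalar[OF A c])
  also have "\<dots> = \<mu> * (y \<bullet> x)" using x c by (simp add: eigenvector_def)
  finally show ?thesis using xy by simp
qed

text \<open>A positive left eigenvector \<open>y\<close> for \<open>l\<close> pairs nontrivially with every eigenvector of maximal modulus,
as these are multiples of positive vectors. Hence \<open>l\<close> is the only eigenvalue of maximal modulus and no
eigenvector for \<open>l\<close> is orthogonal to \<open>y\<close>; so the scaled powers converge, and simplicity follows from
the trace of the limit. The eigenvalue \<open>l\<close> need not be real: a positive matrix times a root of unity
is power positive.\<close>

lemma power_positive_perron: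
  assumes A: "A \<in> carrier_mat n n" and n: "n > 0" and pp: "power_positive A"
    and l: "eigenvalue A l" and max: "\<And>\<mu>. eigenvalue A \<mu> \<Longrightarrow> cmod \<mu> \<le> cmod l"
  shows "l \<noteq> 0" and "strictly_dominant A l" and "\<exists>x y. pos_eigenvectors A l x y"
    and "order l (char_poly A) = 1"
proof -
  have At: "transpose_mat A \<in> carrier_mat n n" using A by simp
  have ev_t: "eigenvalue (transpose_mat A) \<mu> \<longleftrightarrow> eigenvalue A \<mu>" for \<mu>
    by (simp add: eigenvalue_root_char_poly[OF A] eigenvalue_root_char_poly[OF At] char_poly_transpose_mat[OF A])
  obtain x where x: "pos_vec x" "eigenvector A x l"
    using l power_positive_peripheral_eigenvector[OF A n pp _ max] by (auto simp: eigenvalue_def)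
  obtain y where y: "pos_vec y" "eigenvector (transpose_mat A) y l"
    using l power_positive_peripheral_eigenvector[OF At n power_positive_transpose[OF A pp], of _ l] ev_t max
    by (metis eigenvalue_def)
  have carr: "x \<in> carrier_vec n" "y \<in> carrier_vec n"
    using x y A by (auto simp: eigenvector_def)
  have ev: "pos_eigenvectors A l x y"
    using x y by (simp add: pos_eigenvectors_def left_eigenvector_def)
  then show "\<exists>x y. pos_eigenvectors A l x y" by blast
  have peripheral: "\<mu> = l \<and> y \<bullet> v \<noteq> 0" if v: "eigenvector A v \<mu>" and \<mu>: "cmod \<mu> = cmod l" for v \<mu>
  proof -
    obtain c w where cw: "c \<noteq> 0" "pos_vec w" "eigenvector A w \<mu>" "v = c \<cdot>\<^sub>v w"
      using power_positive_peripheral_eigenvector[OF A n pp v] max \<mu> by auto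
    have w: "w \<in> carrier_vec n" using cw A by (auto simp: eigenvector_def)
    have yw: "y \<bullet> w \<noteq> 0"
      using pos_vec_scalar_prod[OF carr(2) w y(1) cw(2) n] by (rule pos_complex_nonzero)
    then show ?thesis
      using left_right_eigenvalues_agree[OF A cw(3) y(2)] cw carr w by simp
  qed
  show dom: "strictly_dominant A l"
    unfolding strictly_dominant_def using peripheral max
    by (metis eigenvalue_def order_le_imp_less_or_eq)
  show l0: "l \<noteq> 0"
  proof
    assume "l = 0"
    obtain k where k: "k \<ge> 1" "pos_mat (A ^\<^sub>m k)"
      using pp by (auto simp: power_positive_def)
    have "(A ^\<^sub>m k *\<^sub>v x) $ 0 = 0"
      using eigenvector_pow[OF A x(2), of k] \<open>l = 0\<close> k carr n by (simp add: zero_power)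
    moreover have "pos_complex (\<Sum>j<n. (A ^\<^sub>m k) $$ (0,j) * x $ j)"
      using k x A carr n by (intro pos_complex_sum pos_complex_mult) (auto simp: pos_mat_def pos_vec_def)
    ultimately show False
      using mult_mat_vec_sum[OF pow_carrier_mat[OF A] carr(1) n] pos_complex_nonzero by metis
  qed
  let ?B = "inverse l \<cdot>\<^sub>m A"
  have B: "?B \<in> carrier_mat n n" using A by simp
  have "y \<bullet> v \<noteq> 0" if "eigenvector ?B v 1" for v
    using peripheral[of v l] eigenvector_smult_iff[OF A, of "inverse l" v l] that l0 by simp
  then have "mat_tendsto (\<lambda>p. ?B ^\<^sub>m p) (spectral_projector x y)"
    by (intro powers_tendsto_projector_if_no_fixed_vector[OF B carr pos_eigenvectors_scaled[OF A n l0 ev] n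
          strictly_dominant_scaled[OF A l0 dom]])
  then show "order l (char_poly A) = 1"
    using powers_tendsto_iff_simple[OF A n l0 dom ev] by simp
qed

lemma positive_eigenvectors_dpr1:
  assumes A: "A \<in> carrier_mat n n" and n: "n > 0" and l: "l \<noteq> 0"
    and ev: "pos_eigenvectors A l x y"
  shows "\<exists>C. weakly_doubly_stochastic C \<and> dpr1_similar (inverse l \<cdot>\<^sub>m A) C"
proof -
  \<comment> \<open>The left eigenvector is normalized so that \<open>x \<bullet> z\<close> equals \<open>e \<bullet> e = n\<close>.\<close>
  define z where "z = (of_nat n / (x \<bullet> y)) \<cdot>\<^sub>v y"
  let ?B = "inverse l \<cdot>\<^sub>m A"
  have B: "?B \<in> carrier_mat n n" and Bt: "transpose_mat ?B \<in> carrier_mat n n" using A by auto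
  note c = pos_eigenvectorsD[OF A ev]
  note fixed = pos_eigenvectors_scaled[OF A n l ev]
  have z: "z \<in> carrier_vec n" using c by (simp add: z_def)
  have Bz: "transpose_mat ?B *\<^sub>v z = z"
    using mult_mat_vec[OF Bt c(2)] fixed(2) by (simp add: z_def)
  have xz: "x \<bullet> z = of_nat n"
    using c fixed(3) by (simp add: z_def)
  have "pos_complex (of_nat n)"
    using n unfolding pos_complex_iff by (intro exI[of _ "real n"]) auto
  then have zpos: "pos_vec z"
    using c pos_vec_scalar_prod[OF c(1-4) n]
    by (auto simp: z_def pos_vec_def divide_inverse intro!: pos_complex_mult pos_complex_inverse)
  have "pos_complex (\<Sum>i<n. x $ i)" "pos_complex (\<Sum>i<n. z $ i)"
    using c z zpos n by (auto intro!: pos_complex_sum simp: pos_vec_def)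
  then obtain X Z where X: "X > 0" "(\<Sum>i<n. x $ i) = complex_of_real X"
    and Z: "Z > 0" "(\<Sum>i<n. z $ i) = complex_of_real Z"
    unfolding pos_complex_iff by blast
  \<comment> \<open>The values \<open>n / X\<close> and \<open>Z / n\<close> are to be avoided; both are positive, so their sum differs from each.\<close>
  define t where "t = real n / X + Z / real n"
  have t: "t > 0" "t * X \<noteq> real n" "Z \<noteq> t * real n"
    using X Z n by (auto simp: t_def field_simps intro!: add_pos_pos)
  have "complex_of_real t * (\<Sum>i<n. x $ i) \<noteq> of_nat n"
    unfolding X using t(2) by (metis of_real_eq_iff of_real_mult of_real_of_nat_eq)
  moreover have "(\<Sum>i<n. z $ i) \<noteq> complex_of_real t * of_nat n"
    unfolding Z using t(3) by (metis of_real_eq_iff of_real_mult of_real_of_nat_eq)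
  ultimately show ?thesis
    using weakly_doubly_stochastic_via_dpr1[OF B c(1) z fixed(1) Bz xz, of "complex_of_real t"] t(1)
    by simp
qed

lemma eigenvalue_listing_head:
  assumes A: "A \<in> carrier_mat n n" and n: "n > 0" and ls: "eigenvalue_listing A ls"
  shows "eigenvalue A (ls ! 0)" and "eigenvalue A \<mu> \<Longrightarrow> cmod \<mu> \<le> cmod (ls ! 0)"
    and "(1 < length ls \<longrightarrow> cmod (ls ! 1) < cmod (ls ! 0)) \<longleftrightarrow> strictly_dominant A (ls ! 0)"
proof -
  have d: "distinct ls" and s: "set ls = {\<mu>. eigenvalue A \<mu>}"
    and sorted: "sorted_wrt (\<lambda>a b. cmod a \<ge> cmod b) ls"
    using ls by (auto simp: eigenvalue_listing_def spectrum_def)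
  obtain l ms where lms: "ls = l # ms"
    using spectrum_non_empty[OF A n] s by (cases ls) (auto simp: spectrum_def)
  show "eigenvalue A (ls ! 0)" using s lms by auto
  show "cmod \<mu> \<le> cmod (ls ! 0)" if "eigenvalue A \<mu>"
    using that s sorted lms by (auto simp: set_eq_iff)
  show "(1 < length ls \<longrightarrow> cmod (ls ! 1) < cmod (ls ! 0)) \<longleftrightarrow> strictly_dominant A (ls ! 0)"
  proof -
    have "strictly_dominant A l \<longleftrightarrow> (\<forall>\<mu>\<in>set ms. cmod \<mu> < cmod l)"
      using s d lms by (auto simp: strictly_dominant_def set_eq_iff)
    also have "\<dots> \<longleftrightarrow> (ms \<noteq> [] \<longrightarrow> cmod (ms ! 0) < cmod l)"
      using sorted lms by (cases ms) (auto intro: order.strict_trans1)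
    finally show ?thesis using lms by (cases ms) auto
  qed
qed

lemma simple_dominant_iff_powers_tendsto:
  assumes A: "A \<in> carrier_mat n n" and n: "n > 0" and ls: "eigenvalue_listing A ls"
    and ex: "\<exists>x y. pos_eigenvectors A (ls ! 0) x y"
  shows "simple_dominant A ls \<longleftrightarrow> powers_tendsto_positive A (ls ! 0)"
proof
  let ?l = "ls ! 0"
  note head = eigenvalue_listing_head[OF A n ls]
  {
    assume "simple_dominant A ls"
    then have l: "?l \<noteq> 0" "order ?l (char_poly A) = 1" and dom: "strictly_dominant A ?l"
      using head(3) by (auto simp: simple_dominant_def)
    show "powers_tendsto_positive A ?l"
      unfolding powers_tendsto_positive_def spectral_projector_def[symmetric]
      using ex powers_tendsto_iff_simple[OF A n l(1) dom] l(2)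
        pos_mat_spectral_projector[OF pos_eigenvectorsD(1-4)[OF A] n] by blast
  next
    assume lim: "powers_tendsto_positive A ?l"
    obtain x y where ev: "pos_eigenvectors A ?l x y" using ex by blast
    have L: "spectral_projector x y \<in> carrier_mat n n"
      using pos_eigenvectorsD(1,2)[OF A ev] by (simp add: spectral_projector_def)
    have lim_xy: "mat_tendsto (\<lambda>p. (inverse ?l \<cdot>\<^sub>m A) ^\<^sub>m p) (spectral_projector x y)"
      and pos: "pos_mat (spectral_projector x y)"
      using lim ev by (auto simp: powers_tendsto_positive_def spectral_projector_def)
    have l: "?l \<noteq> 0" by (rule powers_limit_nonzero_eigenvalue[OF A n L pos lim_xy])
    have dom: "strictly_dominant A ?l"
      by (rule strictly_dominant_if_powers_converge[OF A l head(2) L lim_xy])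
    show "simple_dominant A ls"
      using powers_tendsto_iff_simple[OF A n l dom ev] lim_xy l dom head(3)
      by (simp add: simple_dominant_def)
  }
qed

theorem theorem3p8:
  fixes A :: "complex mat" and n :: nat and ls :: "complex list"
  assumes "n \<ge> 1" and "A \<in> carrier_mat n n" and "eigenvalue_listing A ls"
  shows "(power_positive A \<longrightarrow>
            simple_dominant A ls \<and>
            powers_tendsto_positive A (ls ! 0) \<and>
            (\<exists>B. weakly_doubly_stochastic B \<and> dpr1_similar (inverse (ls ! 0) \<cdot>\<^sub>m A) B)) \<and>
         ((\<exists>x y. pos_eigenvectors A (ls ! 0) x y) \<longrightarrow>
            (simple_dominant A ls \<longleftrightarrow> powers_tendsto_positive A (ls ! 0)))"
proof (intro conjI[of "_ \<longrightarrow> _"] impI)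
  have n: "n > 0" using assms(1) by simp
  note head = eigenvalue_listing_head[OF assms(2) n assms(3)]
  note equiv = simple_dominant_iff_powers_tendsto[OF assms(2) n assms(3)]
  show "simple_dominant A ls \<longleftrightarrow> powers_tendsto_positive A (ls ! 0)"
    if "\<exists>x y. pos_eigenvectors A (ls ! 0) x y"
    using equiv that .
  assume pp: "power_positive A"
  note perron = power_positive_perron[OF assms(2) n pp head(1,2)]
  have "simple_dominant A ls"
    using perron head(3) by (simp add: simple_dominant_def)
  moreover obtain x y where "pos_eigenvectors A (ls ! 0) x y" using perron(3) by blast
  ultimately show "simple_dominant A ls \<and>
            powers_tendsto_positive A (ls ! 0) \<and>
            (\<exists>B. weakly_doubly_stochastic B \<and> dpr1_similar (inverse (ls ! 0) \<cdot>\<^sub>m A) B)"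
    using equiv positive_eigenvectors_dpr1[OF assms(2) n perron(1)] by blast
qed

end
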